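(* Let $U\subseteq\mathbb{R}^m$ be nonempty, let $W\subseteq\mathbb{R}^n$ contain the origin, and let $f\colon\mathbb{R}^n\times U\to\mathbb{R}^n$ be such that $f(\cdot,u)$ is locally Lipschitz for all $u\in U$; consider the perturbed control system $\dot x\in f(x,u)+W$. Let $S_i=(X_i,X_i,U_i,U_i,X_i,F_i,\mathrm{id})$, $i\in\{1,2\}$, be simple systems, let $\bar X_2\subseteq X_2$, and let $\tau>0$. Suppose that $S_1$ is the sampled system associated with the control system $\dot x\in f(x,u)+W$ and sampling time $\tau$. Let $\beta$ be a growth bound on $\bigcup_{x_2\in\bar X_2}x_2$, $U_2$ associated with $\tau$ and $\dot x\in f(x,u)+W$. If $S_2$ is an abstraction of $S_1$ based on $\bar X_2$ and $\beta$, then $S_1\preccurlyeq_{\in}S_2$.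
   Context: Notation. $\mathbb{R}_+=[0,\infty[$. For vectors, $\le,\ge$ and $|\cdot|$ are understood component-wise. For $a,b\in(\mathbb{R}\cup\{\pm\infty\})^n$ with $a\le b$, $\llbracket a,b\rrbracket=\mathbb{R}^n\cap([a_1,b_1]\times\cdots\times[a_n,b_n])$ is a closed hyper-interval. $F\colon A\rightrightarrows B$ denotes a set-valued map, identified with a relation in $A\times B$; $F(M)=\bigcup_{a\in M}F(a)$; strict means all values nonempty. A cover of a set $X$ is a set of subsets of $X$ whose union equals $X$. $\in$ denotes the set membership relation $\{(x,\Omega)\in X_1\times X_2: x\in\Omega\}$. Simple systems and feedback refinement relations. A simple system $S=(X,X,U,U,X,F,\mathrm{id})$ consists of nonempty sets $X$ (state alphabet, all states initial, and output alphabet) and $U$ (input alphabet), a transition function $F\colon X\times U\rightrightarrows X$ and output function $\mathrm{id}$. Let $U_S(x)=\{u\in U: F(x,u)\neq\emptyset\}$. For simple systems $S_1,S_2$ with $U_2\subseteq U_1$, a strict relation $Q\subseteq X_1\times X_2$ is a feedback refinement relation from $S_1$ to $S_2$, written $S_1\preccurlyeq_Q S_2$, if for all $(x_1,x_2)\in Q$: (1) $U_{S_2}(x_2)\subseteq U_{S_1}(x_1)$; (2) $u\in U_{S_2}(x_2)$ implies $Q(F_1(x_1,u))\subseteq F_2(x_2,u)$. Solutions. For an interval $I\subseteq[0,\tau]$, a solution of $\dot x\in f(x,u)+W$ on $I$ with (constant) input $u\in U$ is an absolutely continuous $\xi\colon I\to\mathbb{R}^n$ with $\dot\xi(t)\in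 f(\xi(t),u)+W$ for almost every $t\in I$. $\varphi$ denotes the general solution of the unperturbed system: $\varphi(\cdot,x_0,u)$ is the unique non-continuable solution of $\dot x=f(x,u)$, $x(0)=x_0$. Sampled system. The simple system $S_1$ is the sampled system associated with $\dot x\in f(x,u)+W$ and sampling time $\tau$ if $X_1=\mathbb{R}^n$, $U_1=U$, and $x_1\in F_1(x_0,u)$ iff there is a solution $\xi$ of $\dot x\in f(x,u)+W$ on $[0,\tau]$ with input $u$ satisfying $\xi(0)=x_0$, $\xi(\tau)=x_1$. Growth bound. For $K\subseteq\mathbb{R}^n$, $U'\subseteq U$, a map $\beta\colon\mathbb{R}_+^n\times U'\to\mathbb{R}_+^n$ is a growth bound on $K$, $U'$ associated with $\tau$ and $\dot x\in f(x,u)+W$ if: (1) $\beta(r,u)\ge\beta(r',u)$ whenever $r\ge r'$ and $u\in U'$; (2) $[0,\tau]\times K\times U'\subseteq\operatorname{dom}\varphi$, and if $\xi$ is a solution of $\dot x\in f(x,u)+W$ on $[0,\tau]$ with input $u\in U'$ and $\xi(0),p\in K$, then $|\xi(\tau)-\varphi(\tau,p,u)|\le\beta(|\xi(0)-p|,u)$ component-wise. Abstraction. Let $S_1=(X_1,X_1,U_1,U_1,X_1,F_1,\mathrm{id})$ be the sampled system associated with $\dot x\in f(x,u)+W$ and sampling time $\tau$, $S_2=(X_2,X_2,U_2,U_2,X_2,F_2,\mathrm{id})$ simple, $\bar X_2\subseteq X_2$ and $\beta\colon\mathbb{R}_+^n\times U_2\to\mathbb{R}_+^n$. $S_2$ is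 an abstraction of $S_1$ based on $\bar X_2$ and $\beta$ if: (1) $X_2$ is a cover of $X_1$ by nonempty closed hyper-intervals and every $x_2\in\bar X_2$ is compact; (2) $U_2\subseteq U_1$; (3) for all $x_2\in\bar X_2$, $x_2'\in X_2$, $u\in U_2$: $(\varphi(\tau,c,u)+\llbracket-r',r'\rrbracket)\cap x_2'\neq\emptyset$ implies $x_2'\in F_2(x_2,u)$, where $\llbracket a,b\rrbracket=x_2$, $c=\frac{b+a}{2}$, $r=\frac{b-a}{2}$, $r'=\beta(r,u)$; (4) $F_2(x_2,u)=\emptyset$ whenever $x_2\in X_2\setminus\bar X_2$ and $u\in U_2$. *)

theory Defs
  imports "HOL-Analysis.Analysis"
begin

text \<open>A simple system \<open>(X, X, U, U, X, F, id)\<close> is determined by \<open>X\<close>, \<open>U\<close> and \<open>F\<close>,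
  so only these three components are recorded.\<close>

record ('x, 'u) simple_system =
  states :: "'x set"
  inputs :: "'u set"
  trans_fun :: "'x \<Rightarrow> 'u \<Rightarrow> 'x set"

definition is_simple_system :: "('x, 'u) simple_system \<Rightarrow> bool" where
  "is_simple_system S \<longleftrightarrow>
     states S \<noteq> {} \<and> inputs S \<noteq> {} \<and>
     (\<forall>x\<in>states S. \<forall>u\<in>inputs S. trans_fun S x u \<subseteq> states S)"

definition enabled_inputs :: "('x, 'u) simple_system \<Rightarrow> 'x \<Rightarrow> 'u set" where
  "enabled_inputs S x = {u \<in> inputs S. trans_fun S x u \<noteq> {}}"

definition feedback_refinement ::
  "('x, 'u) simple_system \<Rightarrow> ('x \<times> 'y) set \<Rightarrow> ('y, 'u) simple_system \<Rightarrow> bool" where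
  "feedback_refinement S1 Q S2 \<longleftrightarrow>
     inputs S2 \<subseteq> inputs S1 \<and>
     Q \<subseteq> states S1 \<times> states S2 \<and>
     (\<forall>x1\<in>states S1. \<exists>x2. (x1, x2) \<in> Q) \<and>
     (\<forall>(x1, x2)\<in>Q.
        enabled_inputs S2 x2 \<subseteq> enabled_inputs S1 x1 \<and>
        (\<forall>u\<in>enabled_inputs S2 x2. Q `` trans_fun S1 x1 u \<subseteq> trans_fun S2 x2 u))"

definition membership_rel :: "'x set \<Rightarrow> 'x set set \<Rightarrow> ('x \<times> 'x set) set" where
  "membership_rel X1 X2 = {(x, \<Omega>). x \<in> X1 \<and> \<Omega> \<in> X2 \<and> x \<in> \<Omega>}"

text \<open>Endpoints may be infinite, so that e.g. half-spaces and the whole space are included.\<close>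

definition hyper_interval :: "ereal ^ 'n \<Rightarrow> ereal ^ 'n \<Rightarrow> (real ^ 'n) set" where
  "hyper_interval a b = {x. \<forall>i. a $ i \<le> ereal (x $ i) \<and> ereal (x $ i) \<le> b $ i}"

definition closed_hyper_interval :: "(real ^ 'n) set \<Rightarrow> bool" where
  "closed_hyper_interval X \<longleftrightarrow> (\<exists>a b. a \<le> b \<and> X = hyper_interval a b)"

text \<open>Absolute continuity on an interval, in the epsilon-delta sense over finite families of
  non-overlapping intervals. On a non-compact interval it is required on each compact
  subinterval, as is usual for solutions of differential equations; on a compact interval this
  is ordinary absolute continuity. (The library constant \<open>absolutely_continuous\<close> is about measures.)\<close>

definition abs_continuous_on :: "real set \<Rightarrow> (real \<Rightarrow> 'a::real_normed_vector) \<Rightarrow> bool" where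
  "abs_continuous_on I \<xi> \<longleftrightarrow>
     (\<forall>a b. a \<le> b \<and> {a..b} \<subseteq> I \<longrightarrow>
       (\<forall>\<epsilon>>0. \<exists>\<delta>>0. \<forall>D :: (real \<times> real) set.
          finite D \<and>
          (\<forall>(s, t)\<in>D. a \<le> s \<and> s \<le> t \<and> t \<le> b) \<and>
          pairwise (\<lambda>(s, t) (s', t'). disjnt {s<..<t} {s'<..<t'}) D \<and>
          (\<Sum>(s, t)\<in>D. t - s) < \<delta>
          \<longrightarrow> (\<Sum>(s, t)\<in>D. norm (\<xi> t - \<xi> s)) < \<epsilon>))"

definition is_solution ::
  "(real ^ 'n \<Rightarrow> real ^ 'm \<Rightarrow> real ^ 'n) \<Rightarrow> (real ^ 'n) set \<Rightarrow> real ^ 'm \<Rightarrow>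
   real set \<Rightarrow> (real \<Rightarrow> real ^ 'n) \<Rightarrow> bool" where
  "is_solution f W u I \<xi> \<longleftrightarrow>
     is_interval I \<and> abs_continuous_on I \<xi> \<and>
     (AE t in lborel. t \<in> I \<longrightarrow>
        (\<exists>w\<in>W. (\<xi> has_vector_derivative (f (\<xi> t) u + w)) (at t within I)))"

definition noncontinuable_solution ::
  "(real ^ 'n \<Rightarrow> real ^ 'm \<Rightarrow> real ^ 'n) \<Rightarrow> real ^ 'n \<Rightarrow> real ^ 'm \<Rightarrow>
   real set \<Rightarrow> (real \<Rightarrow> real ^ 'n) \<Rightarrow> bool" where
  "noncontinuable_solution f x0 u J \<xi> \<longleftrightarrow>
     0 \<in> J \<and> is_solution f {0} u J \<xi> \<and> \<xi> 0 = x0 \<and>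
     (\<forall>J' \<eta>. J \<subseteq> J' \<and> is_solution f {0} u J' \<eta> \<and> (\<forall>t\<in>J. \<eta> t = \<xi> t) \<longrightarrow> J' = J)"

text \<open>The general solution and its domain. If \<open>f\<close> is locally Lipschitz in its first argument,
  the non-continuable solution is unique, hence so is the value selected by \<open>THE\<close> at every
  point of the domain; outside the domain the value is meaningless.\<close>

definition general_solution_dom ::
  "(real ^ 'n \<Rightarrow> real ^ 'm \<Rightarrow> real ^ 'n) \<Rightarrow> (real ^ 'm) set \<Rightarrow>
   (real \<times> (real ^ 'n) \<times> (real ^ 'm)) set" where
  "general_solution_dom f U =
     {(t, x0, u). u \<in> U \<and> (\<exists>J \<xi>. noncontinuable_solution f x0 u J \<xi> \<and> t \<in> J)}"

definition general_solution ::
  "(real ^ 'n \<Rightarrow> real ^ 'm \<Rightarrow> real ^ 'n) \<Rightarrow> real \<Rightarrow> real ^ 'n \<Rightarrow> real ^ 'm \<Rightarrow> real ^ 'n" where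
  "general_solution f t x0 u =
     (THE y. \<exists>J \<xi>. noncontinuable_solution f x0 u J \<xi> \<and> t \<in> J \<and> y = \<xi> t)"

definition sampled_system ::
  "(real ^ 'n \<Rightarrow> real ^ 'm \<Rightarrow> real ^ 'n) \<Rightarrow> (real ^ 'n) set \<Rightarrow> (real ^ 'm) set \<Rightarrow> real \<Rightarrow>
   (real ^ 'n, real ^ 'm) simple_system \<Rightarrow> bool" where
  "sampled_system f W U \<tau> S \<longleftrightarrow>
     states S = UNIV \<and> inputs S = U \<and>
     (\<forall>x0 x1. \<forall>u\<in>U. x1 \<in> trans_fun S x0 u \<longleftrightarrow>
        (\<exists>\<xi>. is_solution f W u {0..\<tau>} \<xi> \<and> \<xi> 0 = x0 \<and> \<xi> \<tau> = x1))"

text \<open>The order and the absolute value on vectors are the component-wise ones.\<close>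

definition nonneg_map :: "(real ^ 'm) set \<Rightarrow> (real ^ 'n \<Rightarrow> real ^ 'm \<Rightarrow> real ^ 'n) \<Rightarrow> bool" where
  "nonneg_map U' \<beta> \<longleftrightarrow> (\<forall>r\<ge>0. \<forall>u\<in>U'. \<beta> r u \<ge> 0)"

definition growth_bound ::
  "(real ^ 'n \<Rightarrow> real ^ 'm \<Rightarrow> real ^ 'n) \<Rightarrow> (real ^ 'n) set \<Rightarrow> (real ^ 'm) set \<Rightarrow> real \<Rightarrow>
   (real ^ 'n) set \<Rightarrow> (real ^ 'm) set \<Rightarrow> (real ^ 'n \<Rightarrow> real ^ 'm \<Rightarrow> real ^ 'n) \<Rightarrow> bool" where
  "growth_bound f W U \<tau> K U' \<beta> \<longleftrightarrow>
     U' \<subseteq> U \<and> nonneg_map U' \<beta> \<and>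
     (\<forall>r r'. \<forall>u\<in>U'. 0 \<le> r' \<and> r' \<le> r \<longrightarrow> \<beta> r' u \<le> \<beta> r u) \<and>
     {0..\<tau>} \<times> K \<times> U' \<subseteq> general_solution_dom f U \<and>
     (\<forall>\<xi> p. \<forall>u\<in>U'. is_solution f W u {0..\<tau>} \<xi> \<and> \<xi> 0 \<in> K \<and> p \<in> K \<longrightarrow>
        \<bar>\<xi> \<tau> - general_solution f \<tau> p u\<bar> \<le> \<beta> \<bar>\<xi> 0 - p\<bar> u)"

text \<open>In the third condition below, \<open>a\<close> and \<open>b\<close> are real since \<open>x2\<close> is compact, and they are
  determined by \<open>x2\<close> since \<open>x2\<close> is nonempty.\<close>

definition abstraction_of ::
  "(real ^ 'n \<Rightarrow> real ^ 'm \<Rightarrow> real ^ 'n) \<Rightarrow> real \<Rightarrow>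
   (real ^ 'n, real ^ 'm) simple_system \<Rightarrow> ((real ^ 'n) set, real ^ 'm) simple_system \<Rightarrow>
   (real ^ 'n) set set \<Rightarrow> (real ^ 'n \<Rightarrow> real ^ 'm \<Rightarrow> real ^ 'n) \<Rightarrow> bool" where
  "abstraction_of f \<tau> S1 S2 X2bar \<beta> \<longleftrightarrow>
     X2bar \<subseteq> states S2 \<and> nonneg_map (inputs S2) \<beta> \<and>
     \<Union> (states S2) = states S1 \<and>
     (\<forall>x2\<in>states S2. x2 \<noteq> {} \<and> closed_hyper_interval x2) \<and>
     (\<forall>x2\<in>X2bar. compact x2) \<and>
     inputs S2 \<subseteq> inputs S1 \<and>
     (\<forall>x2\<in>X2bar. \<forall>x2'\<in>states S2. \<forall>u\<in>inputs S2. \<forall>a b. {a..b} = x2 \<longrightarrow>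
        (let c = (1 / 2) *\<^sub>R (b + a); r = (1 / 2) *\<^sub>R (b - a); r' = \<beta> r u in
           (\<lambda>y. general_solution f \<tau> c u + y) ` {- r'..r'} \<inter> x2' \<noteq> {} \<longrightarrow>
           x2' \<in> trans_fun S2 x2 u)) \<and>
     (\<forall>x2\<in>states S2 - X2bar. \<forall>u\<in>inputs S2. trans_fun S2 x2 u = {})"

end

theory Submission
  imports Defs
begin

text \<open>
  Suppose \<open>x1 \<in> x2\<close> and the input \<open>u\<close> is enabled at the cell \<open>x2\<close>. Cells outside \<open>X2bar\<close> have no
  enabled input, so \<open>x2\<close> is a compact box \<open>{a..b}\<close> with centre \<open>c\<close> and radius \<open>r\<close>
  (\<open>compact_hyper_interval_eq_box\<close>).

  The first requirement on a feedback refinement relation, that \<open>u\<close> is enabled at \<open>x1\<close>, holds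
  because the growth bound demands that unperturbed solutions starting in \<open>X2bar\<close>-cells survive
  until time \<open>\<tau>\<close>; as \<open>0 \<in> W\<close>, such a solution is also one of the perturbed system
  (\<open>solution_from_general_solution_dom\<close>).

  For the second requirement let a perturbed solution lead from \<open>x1\<close> to \<open>x1'\<close> in a cell \<open>x2'\<close>.
  Since \<open>\<bar>x1 - c\<bar> \<le> r\<close>, the growth bound and its monotonicity place \<open>x1'\<close> within \<open>\<beta> r u\<close> of the
  nominal end point of the trajectory through \<open>c\<close>. So \<open>x1'\<close> witnesses that \<open>x2'\<close> meets the
  over-approximating box, and the construction of the abstraction makes \<open>x2'\<close> a successor of \<open>x2\<close>.
\<close>

text \<open>
  The end points of a closed hyper-interval may be infinite. By compactness every coordinate
  attains its extrema on the set; these are real, and they can serve as end points because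
  membership is decided coordinate by coordinate.
\<close>

lemma compact_hyper_interval_eq_box:
  fixes X :: "(real ^ 'n) set"
  assumes "closed_hyper_interval X" "compact X" "X \<noteq> {}"
  obtains a b where "X = {a..b}"
proof -
  obtain a' b' where X: "X = hyper_interval a' b'"
    using assms(1) unfolding closed_hyper_interval_def by blast
  have cont: "continuous_on X (\<lambda>x. x $ i)" for i
    by (intro continuous_intros)
  have "\<exists>p\<in>X. \<forall>y\<in>X. p $ i \<le> y $ i" for i
    using continuous_attains_inf[OF assms(2,3) cont] by blast
  then obtain p where p: "\<And>i. p i \<in> X" "\<And>i y. y \<in> X \<Longrightarrow> p i $ i \<le> y $ i"
    by metis
  have "\<exists>q\<in>X. \<forall>y\<in>X. y $ i \<le> q $ i" for i
    using continuous_attains_sup[OF assms(2,3) cont] by blast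
  then obtain q where q: "\<And>i. q i \<in> X" "\<And>i y. y \<in> X \<Longrightarrow> y $ i \<le> q i $ i"
    by metis
  have "X = {(\<chi> i. p i $ i)..(\<chi> i. q i $ i)}"
  proof (intro equalityI subsetI)
    fix x assume "x \<in> X"
    then show "x \<in> {(\<chi> i. p i $ i)..(\<chi> i. q i $ i)}"
      using p(2) q(2) by (simp add: less_eq_vec_def)
  next
    fix x assume x: "x \<in> {(\<chi> i. p i $ i)..(\<chi> i. q i $ i)}"
    have "a' $ i \<le> ereal (x $ i) \<and> ereal (x $ i) \<le> b' $ i" for i
    proof -
      have "a' $ i \<le> ereal (p i $ i)" "ereal (q i $ i) \<le> b' $ i"
        using p(1)[of i] q(1)[of i] unfolding X hyper_interval_def by auto
      moreover have "ereal (p i $ i) \<le> ereal (x $ i)" "ereal (x $ i) \<le> ereal (q i $ i)"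
        using x by (simp_all add: less_eq_vec_def)
      ultimately show ?thesis
        by (meson order_trans)
    qed
    then show "x \<in> X"
      unfolding X hyper_interval_def by blast
  qed
  then show thesis
    by (rule that)
qed

lemma abs_continuous_on_subset:
  assumes "abs_continuous_on J \<xi>" "I \<subseteq> J"
  shows "abs_continuous_on I \<xi>"
  using assms unfolding abs_continuous_on_def by (meson order_trans)

lemma is_solution_mono:
  assumes sol: "is_solution f V u J \<xi>" and "V \<subseteq> W" "I \<subseteq> J" "is_interval I"
  shows "is_solution f W u I \<xi>"
proof -
  have "AE t in lborel. t \<in> J \<longrightarrow>
      (\<exists>w\<in>V. (\<xi> has_vector_derivative (f (\<xi> t) u + w)) (at t within J))"
    using sol unfolding is_solution_def by blast
  then have "AE t in lborel. t \<in> I \<longrightarrow>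
      (\<exists>w\<in>W. (\<xi> has_vector_derivative (f (\<xi> t) u + w)) (at t within I))"
  proof eventually_elim
    case (elim t)
    then show ?case
      using \<open>V \<subseteq> W\<close> \<open>I \<subseteq> J\<close> has_vector_derivative_within_subset by (metis subsetD)
  qed
  then show ?thesis
    using assms abs_continuous_on_subset unfolding is_solution_def by blast
qed

text \<open>
  The domain of a non-continuable solution is an interval containing \<open>0\<close>, so it contains
  \<open>{0..\<tau>}\<close> once it contains \<open>\<tau>\<close>.
\<close>

lemma solution_from_general_solution_dom:
  assumes "(\<tau>, x0, u) \<in> general_solution_dom f U" "0 \<in> W"
  obtains \<xi> where "is_solution f W u {0..\<tau>} \<xi>" "\<xi> 0 = x0"
proof -
  obtain J \<xi> where J: "noncontinuable_solution f x0 u J \<xi>" "\<tau> \<in> J"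
    using assms(1) unfolding general_solution_dom_def by blast
  then have sol: "is_solution f {0} u J \<xi>" and "0 \<in> J" "\<xi> 0 = x0"
    unfolding noncontinuable_solution_def by blast+
  have "{0..\<tau>} \<subseteq> J"
    using sol \<open>0 \<in> J\<close> \<open>\<tau> \<in> J\<close> unfolding is_solution_def is_interval_1
    by (meson atLeastAtMost_iff subsetI)
  then have "is_solution f W u {0..\<tau>} \<xi>"
    using is_solution_mono[OF sol] assms(2) is_interval_cc by blast
  then show thesis
    using \<open>\<xi> 0 = x0\<close> by (rule that)
qed

lemma box_centre_radius:
  fixes a b x :: "real ^ 'n"
  assumes "x \<in> {a..b}"
  defines "c \<equiv> (1 / 2) *\<^sub>R (b + a)" and "r \<equiv> (1 / 2) *\<^sub>R (b - a)"
  shows "c \<in> {a..b}" "0 \<le> \<bar>x - c\<bar>" "\<bar>x - c\<bar> \<le> r"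
proof -
  have x: "a $ i \<le> x $ i" "x $ i \<le> b $ i" for i
    using assms(1) by (auto simp: less_eq_vec_def)
  have ab: "a $ i \<le> b $ i" for i
    using x[of i] by linarith
  show "c \<in> {a..b}"
    using ab by (simp add: c_def less_eq_vec_def field_simps)
  show "0 \<le> \<bar>x - c\<bar>"
    by (simp add: less_eq_vec_def abs_vec_def)
  have "\<bar>x $ i - c $ i\<bar> \<le> r $ i" for i
    using x[of i] by (simp add: c_def r_def abs_le_iff field_simps)
  then show "\<bar>x - c\<bar> \<le> r"
    by (simp add: less_eq_vec_def abs_vec_def)
qed

theorem mainTheorem7:
  fixes U :: "(real ^ 'm) set"
    and W :: "(real ^ 'n) set"
    and f :: "real ^ 'n \<Rightarrow> real ^ 'm \<Rightarrow> real ^ 'n"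
    and S1 :: "(real ^ 'n, real ^ 'm) simple_system"
    and S2 :: "((real ^ 'n) set, real ^ 'm) simple_system"
    and X2bar :: "(real ^ 'n) set set"
    and \<tau> :: real
    and \<beta> :: "real ^ 'n \<Rightarrow> real ^ 'm \<Rightarrow> real ^ 'n"
  assumes "U \<noteq> {}"
    and "0 \<in> W"
    and "\<forall>u\<in>U. local_lipschitz (UNIV :: real set) UNIV (\<lambda>_ x. f x u)"
    and "is_simple_system S1"
    and "is_simple_system S2"
    and "X2bar \<subseteq> states S2"
    and "\<tau> > 0"
    and "sampled_system f W U \<tau> S1"
    and "growth_bound f W U \<tau> (\<Union> X2bar) (inputs S2) \<beta>"
    and "abstraction_of f \<tau> S1 S2 X2bar \<beta>"
  shows "feedback_refinement S1 (membership_rel (states S1) (states S2)) S2"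
proof -
  let ?Q = "membership_rel (states S1) (states S2)"
  have inputs: "inputs S2 \<subseteq> U"
    and mono: "\<And>r r' u. u \<in> inputs S2 \<Longrightarrow> 0 \<le> r' \<Longrightarrow> r' \<le> r \<Longrightarrow> \<beta> r' u \<le> \<beta> r u"
    and dom: "{0..\<tau>} \<times> \<Union> X2bar \<times> inputs S2 \<subseteq> general_solution_dom f U"
    and bound: "\<And>\<xi> p u. u \<in> inputs S2 \<Longrightarrow> is_solution f W u {0..\<tau>} \<xi> \<Longrightarrow>
        \<xi> 0 \<in> \<Union> X2bar \<Longrightarrow> p \<in> \<Union> X2bar \<Longrightarrow>
        \<bar>\<xi> \<tau> - general_solution f \<tau> p u\<bar> \<le> \<beta> \<bar>\<xi> 0 - p\<bar> u"
    using assms(9) unfolding growth_bound_def by (elim conjE; simp)+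
  have cover: "\<Union> (states S2) = states S1"
    and cells: "\<And>x2. x2 \<in> states S2 \<Longrightarrow> x2 \<noteq> {} \<and> closed_hyper_interval x2"
    and compact: "\<And>x2. x2 \<in> X2bar \<Longrightarrow> compact x2"
    and blocked: "\<And>x2 u. x2 \<in> states S2 - X2bar \<Longrightarrow> u \<in> inputs S2 \<Longrightarrow> trans_fun S2 x2 u = {}"
    using assms(10) unfolding abstraction_of_def by (elim conjE; simp)+
  have succ: "\<forall>x2\<in>X2bar. \<forall>x2'\<in>states S2. \<forall>u\<in>inputs S2. \<forall>a b. {a..b} = x2 \<longrightarrow>
      (\<lambda>y. general_solution f \<tau> ((1 / 2) *\<^sub>R (b + a)) u + y) `
        {- \<beta> ((1 / 2) *\<^sub>R (b - a)) u..\<beta> ((1 / 2) *\<^sub>R (b - a)) u} \<inter> x2' \<noteq> {} \<longrightarrow>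
      x2' \<in> trans_fun S2 x2 u"
    using assms(10) unfolding abstraction_of_def Let_def by (elim conjE)
  have S1: "states S1 = UNIV" "inputs S1 = U"
    and step: "\<And>x0 x1 u. u \<in> U \<Longrightarrow> x1 \<in> trans_fun S1 x0 u \<longleftrightarrow>
        (\<exists>\<xi>. is_solution f W u {0..\<tau>} \<xi> \<and> \<xi> 0 = x0 \<and> \<xi> \<tau> = x1)"
    using assms(8) unfolding sampled_system_def by (elim conjE; simp)+
  have Q: "(x1, x2) \<in> ?Q \<longleftrightarrow> x2 \<in> states S2 \<and> x1 \<in> x2" for x1 x2
    by (auto simp: membership_rel_def S1)
  have strict: "\<exists>x2. (x1, x2) \<in> ?Q" for x1
    using cover S1(1) unfolding Q by blast
  have bar: "x2 \<in> X2bar" if "x2 \<in> states S2" "u \<in> enabled_inputs S2 x2" for x2 u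
    using blocked that unfolding enabled_inputs_def by blast
  have enabled: "u \<in> enabled_inputs S1 x1"
    if x: "(x1, x2) \<in> ?Q" and u: "u \<in> enabled_inputs S2 x2" for x1 x2 u
  proof -
    have u2: "u \<in> inputs S2"
      using u unfolding enabled_inputs_def by blast
    have "(\<tau>, x1, u) \<in> {0..\<tau>} \<times> \<Union> X2bar \<times> inputs S2"
      using x bar[OF _ u] u2 \<open>\<tau> > 0\<close> unfolding Q by auto
    then have "(\<tau>, x1, u) \<in> general_solution_dom f U"
      using dom by (rule subsetD[rotated])
    then obtain \<xi> where "is_solution f W u {0..\<tau>} \<xi>" "\<xi> 0 = x1"
      using \<open>0 \<in> W\<close> by (rule solution_from_general_solution_dom)
    then have "\<xi> \<tau> \<in> trans_fun S1 x1 u"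
      using step inputs u2 by blast
    then show ?thesis
      using inputs u2 S1(2) unfolding enabled_inputs_def by blast
  qed
  have simulated: "x2' \<in> trans_fun S2 x2 u"
    if x: "(x1, x2) \<in> ?Q" and u: "u \<in> enabled_inputs S2 x2"
      and x1': "x1' \<in> trans_fun S1 x1 u" and x': "(x1', x2') \<in> ?Q" for x1 x2 u x1' x2'
  proof -
    have u2: "u \<in> inputs S2"
      using u unfolding enabled_inputs_def by blast
    have x2: "x2 \<in> X2bar"
      using x bar[OF _ u] unfolding Q by blast
    then have "closed_hyper_interval x2" "compact x2" "x2 \<noteq> {}"
      using cells compact assms(6) by blast+
    then obtain a b where ab: "x2 = {a..b}"
      by (rule compact_hyper_interval_eq_box)
    define c where "c = (1 / 2) *\<^sub>R (b + a)"
    define r where "r = (1 / 2) *\<^sub>R (b - a)"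
    have "x1 \<in> {a..b}"
      using x ab unfolding Q by blast
    note box = box_centre_radius[OF this, folded c_def r_def]
    obtain \<xi> where \<xi>: "is_solution f W u {0..\<tau>} \<xi>" "\<xi> 0 = x1" "\<xi> \<tau> = x1'"
      using x1' step inputs u2 by blast
    let ?y = "x1' - general_solution f \<tau> c u"
    have "x1 \<in> \<Union> X2bar" "c \<in> \<Union> X2bar"
      using x2 ab \<open>x1 \<in> {a..b}\<close> box(1) by blast+
    then have "\<bar>?y\<bar> \<le> \<beta> \<bar>x1 - c\<bar> u"
      using bound[OF u2 \<xi>(1)] \<xi>(2,3) by simp
    also have "\<dots> \<le> \<beta> r u"
      using mono u2 box(2,3) by blast
    finally have "\<bar>?y $ i\<bar> \<le> \<beta> r u $ i" for i
      by (simp add: less_eq_vec_def abs_vec_def)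
    then have "- \<beta> r u $ i \<le> ?y $ i" "?y $ i \<le> \<beta> r u $ i" for i
      by (meson abs_le_D1 abs_le_D2 minus_le_iff)+
    then have "?y \<in> {- \<beta> r u..\<beta> r u}"
      by (simp add: less_eq_vec_def)
    then have "general_solution f \<tau> c u + ?y \<in>
        (\<lambda>y. general_solution f \<tau> c u + y) ` {- \<beta> r u..\<beta> r u}"
      by (rule imageI)
    then have meet: "(\<lambda>y. general_solution f \<tau> c u + y) ` {- \<beta> r u..\<beta> r u} \<inter> x2' \<noteq> {}"
      using x' unfolding Q by auto
    have "x2' \<in> states S2"
      using x' unfolding Q by blast
    then show ?thesis
      using meet unfolding c_def r_def by (rule succ[rule_format, OF x2 _ u2 ab[symmetric]])
  qed
  show ?thesis
    unfolding feedback_refinement_def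
  proof (intro conjI)
    show "inputs S2 \<subseteq> inputs S1"
      using inputs S1(2) by blast
    show "?Q \<subseteq> states S1 \<times> states S2"
      unfolding membership_rel_def by blast
    show "\<forall>x1\<in>states S1. \<exists>x2. (x1, x2) \<in> ?Q"
      using strict by blast
    show "\<forall>(x1, x2)\<in>?Q. enabled_inputs S2 x2 \<subseteq> enabled_inputs S1 x1 \<and>
        (\<forall>u\<in>enabled_inputs S2 x2. ?Q `` trans_fun S1 x1 u \<subseteq> trans_fun S2 x2 u)"
      using enabled simulated by blast
  qed
qed

end
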